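(* Let $d$ and $k$ be positive integers. There exist two lattice $(d,k)$-polytopes $P$ and $Q$ such that (i) $d(P,Q)$ is equal to $\varepsilon(d,k)$, (ii) both $P$ and $Q$ are simplices, (iii) $\dim(P)+\dim(Q)$ is equal to $d-1$, and (iv) the affine hulls of $P$ and $Q$ are disjoint.
   Context: A polytope in $\mathbb{R}^d$ is the convex hull of a non-empty finite set of points. A lattice polytope is a polytope all of whose vertices belong to $\mathbb{Z}^d$. A lattice $(d,k)$-polytope is a lattice polytope (of any dimension) contained in the hypercube $[0,k]^d$. $d(P,Q)$ denotes the minimal Euclidean distance between a point of $P$ and a point of $Q$ (the letter $d$ alone denotes the dimension of the ambient space). $\varepsilon(d,k)$ denotes the smallest possible distance $d(P,Q)$ between two disjoint lattice $(d,k)$-polytopes $P$ and $Q$. A simplex is the convex hull of a non-empty set of affinely independent points (a single point is a $0$-dimensional simplex). *)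

theory Defs
  imports "HOL-Analysis.Analysis"
begin

definition integer_points :: "(real ^ 'n) set" where
  "integer_points = {x. \<forall>i. x $ i \<in> \<int>}"

(* The library predicate polytope also holds of the empty set, which is excluded here.
   The vertices of a polytope are its extreme points. *)
definition lattice_polytope :: "(real ^ 'n) set \<Rightarrow> bool" where
  "lattice_polytope P \<longleftrightarrow>
     polytope P \<and> P \<noteq> {} \<and> {v. v extreme_point_of P} \<subseteq> integer_points"

(* Lattice (d,k)-polytopes, where d = CARD('n). *)
definition lattice_dk_polytope :: "nat \<Rightarrow> (real ^ 'n) set \<Rightarrow> bool" where
  "lattice_dk_polytope k P \<longleftrightarrow>
     lattice_polytope P \<and> P \<subseteq> {x. \<forall>i. 0 \<le> x $ i \<and> x $ i \<le> real k}"

(* The quantity epsilon(d,k), with the dimension d = CARD('n) given by a type argument.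
   setdist is the infimum of the pairwise Euclidean distances, a minimum for (compact,
   nonempty) polytopes. The outer infimum is a minimum as well, because there are only
   finitely many lattice (d,k)-polytopes. *)
definition lattice_eps :: "'n::finite itself \<Rightarrow> nat \<Rightarrow> real" where
  "lattice_eps (_ :: 'n itself) k =
     Inf {setdist P Q | P Q :: (real ^ 'n) set.
            lattice_dk_polytope k P \<and> lattice_dk_polytope k Q \<and> P \<inter> Q = {}}"

end

theory Submission
  imports Defs
begin

text \<open>Take a closest pair of points of two polytopes at minimal distance, written as convex
  combinations of vertices. If the vertices involved are affinely dependent, adding a multiple
  of the dependence to the coefficients of the first point, subtracting it from those of the
  second, and renormalising scales the difference of the two points by a factor at most one;
  this can be continued until a vertex drops out. So the distance is attained by the convex
  hulls of two disjoint parts of an affinely independent set. Completing this set to an affine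
  basis within the lattice points of the cube cannot increase the distance, and minimality
  forbids it to decrease.\<close>

section \<open>Reduction to affinely independent vertex sets\<close>

lemma setdist_convex_hulls_remove_vertex:
  fixes A B :: "'a::euclidean_space set"
  assumes fin: "finite A" "finite B" and ne: "A \<noteq> {}" "B \<noteq> {}"
    and disj: "convex hull A \<inter> convex hull B = {}"
    and dep: "affine_dependent (A \<union> B)"
  obtains A' B' where "A' \<subseteq> A" "B' \<subseteq> B" "A' \<noteq> {}" "B' \<noteq> {}"
    "card A' + card B' < card A + card B"
    "setdist (convex hull A') (convex hull B') = setdist (convex hull A) (convex hull B)"
proof -
  have AB: "A \<inter> B = {}"
    using disj hull_subset[of A convex] hull_subset[of B convex] by blast
  obtain p q where p: "p \<in> convex hull A" and q: "q \<in> convex hull B"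
    and pq: "setdist (convex hull A) (convex hull B) = dist p q"
    using setdist_compact_closed[of "convex hull A" "convex hull B"] fin ne
    by (metis compact_imp_closed convex_hull_eq_empty finite_imp_compact_convex_hull)
  have "p \<noteq> q" using p q disj by blast
  obtain a where a: "\<And>x. x \<in> A \<Longrightarrow> 0 \<le> a x" "sum a A = 1" "(\<Sum>x\<in>A. a x *\<^sub>R x) = p"
    using p by (auto simp: convex_hull_finite[OF fin(1)])
  obtain b where b: "\<And>x. x \<in> B \<Longrightarrow> 0 \<le> b x" "sum b B = 1" "(\<Sum>x\<in>B. b x *\<^sub>R x) = q"
    using q by (auto simp: convex_hull_finite[OF fin(2)])
  \<comment> \<open>The parts \<open>A\<close> and \<open>B\<close> are disjoint, so one function
    can carry the coefficients of both points.\<close>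
  define c where "c x = (if x \<in> A then a x else b x)" for x
  have c0: "0 \<le> c x" if "x \<in> A \<union> B" for x
    using that a(1) b(1) by (auto simp: c_def)
  have cA: "sum c A = 1" "(\<Sum>x\<in>A. c x *\<^sub>R x) = p"
    using a by (auto simp: c_def)
  have cB_eq: "c x = b x" if "x \<in> B" for x
    using AB that by (auto simp: c_def)
  then have cB: "sum c B = 1" "(\<Sum>x\<in>B. c x *\<^sub>R x) = q"
    using b by simp_all
  obtain u where u: "sum u (A \<union> B) = 0" "\<exists>v\<in>A \<union> B. u v \<noteq> 0"
      "(\<Sum>v\<in>A \<union> B. u v *\<^sub>R v) = 0"
    using dep fin by (auto simp: affine_dependent_explicit_finite)
  \<comment> \<open>The sign \<open>\<sigma>\<close> makes the mass \<open>s\<close> added to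
    \<open>A\<close> nonnegative. Since \<open>u\<close> sums to zero, flipping its sign on
    \<open>B\<close> gives \<open>w\<close> the same mass \<open>s\<close> there, and likewise the
    same weighted vector sum on both parts.\<close>
  define \<sigma> :: real where "\<sigma> = (if sum u A \<ge> 0 then 1 else - 1)"
  define w where "w x = (if x \<in> A then \<sigma> * u x else - \<sigma> * u x)" for x
  define s where "s = \<sigma> * sum u A"
  have s0: "s \<ge> 0" by (auto simp: s_def \<sigma>_def)
  have "\<sigma> \<noteq> 0" by (simp add: \<sigma>_def)
  have wA: "sum w A = s"
    by (simp add: w_def s_def sum_distrib_left)
  have wB_eq: "w x = - \<sigma> * u x" if "x \<in> B" for x
    using that AB by (auto simp: w_def)
  have "sum u A + sum u B = 0"
    using u(1) by (simp add: sum.union_disjoint fin AB)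
  then have wB: "sum w B = s"
    by (simp add: wB_eq s_def sum_negf flip: sum_distrib_left)
      (metis add.commute minus_add_cancel add.right_neutral add_eq_0_iff minus_mult_right)
  have "(\<Sum>x\<in>A. u x *\<^sub>R x) + (\<Sum>x\<in>B. u x *\<^sub>R x) = 0"
    using u(3) by (simp add: sum.union_disjoint fin AB)
  moreover have "(\<Sum>x\<in>A. w x *\<^sub>R x) = \<sigma> *\<^sub>R (\<Sum>x\<in>A. u x *\<^sub>R x)"
    by (simp add: w_def scaleR_sum_right)
  moreover have "(\<Sum>x\<in>B. w x *\<^sub>R x) = - \<sigma> *\<^sub>R (\<Sum>x\<in>B. u x *\<^sub>R x)"
    by (simp add: wB_eq scaleR_sum_right sum_negf)
  ultimately have wAB: "(\<Sum>x\<in>A. w x *\<^sub>R x) = (\<Sum>x\<in>B. w x *\<^sub>R x)"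
    by (simp add: add_eq_0_iff2)
  \<comment> \<open>Both coefficient families are moved by \<open>t\<close> along \<open>w\<close>
    and divided by the common new mass \<open>1 + t * s\<close>. The shifts of the two points agree
    and cancel in the difference, leaving \<open>(p - q) / (1 + t * s)\<close>. The set
    \<open>Z\<close> collects vertices whose coefficient has become zero.\<close>
  have move: "\<exists>p' q'. p' \<in> convex hull (A - Z) \<and> q' \<in> convex hull (B - Z) \<and>
      dist p' q' = dist p q / (1 + t * s)"
    if t: "t \<ge> 0" and nonneg: "\<And>x. x \<in> A \<union> B \<Longrightarrow> 0 \<le> c x + t * w x"
      and Z: "\<And>x. x \<in> Z \<Longrightarrow> c x + t * w x = 0" for t Z
  proof -
    define r where "r = 1 + t * s"
    have r: "r > 0" using t s0 by (simp add: r_def add_pos_nonneg)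
    define e where "e x = (c x + t * w x) / r" for x
    have eZ: "e x = 0" if "x \<in> Z" for x using Z that by (simp add: e_def)
    have hull: "(\<Sum>x\<in>X. e x *\<^sub>R x) \<in> convex hull (X - Z)"
      if "X \<subseteq> A \<union> B" "sum c X = 1" "sum w X = s" for X
    proof -
      have fX: "finite X" using that fin by (meson finite_UnI finite_subset)
      have "sum e X = 1"
        using that r by (simp add: e_def r_def sum.distrib flip: sum_divide_distrib sum_distrib_left)
      then have "sum e (X - Z) = 1"
        using fX eZ by (subst sum.mono_neutral_left[of X]) auto
      moreover have "0 \<le> e x" if "x \<in> X" for x
        using nonneg[of x] r that \<open>X \<subseteq> A \<union> B\<close> by (auto simp: e_def)
      moreover have "(\<Sum>x\<in>X. e x *\<^sub>R x) = (\<Sum>x\<in>X - Z. e x *\<^sub>R x)"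
        using fX eZ by (intro sum.mono_neutral_right) auto
      ultimately show ?thesis
        using fX by (auto simp: convex_hull_finite)
    qed
    have comb: "(\<Sum>x\<in>X. e x *\<^sub>R x) = (1/r) *\<^sub>R ((\<Sum>x\<in>X. c x *\<^sub>R x) + t *\<^sub>R (\<Sum>x\<in>X. w x *\<^sub>R x))" for X
      by (simp add: e_def scaleR_sum_right sum.distrib scaleR_add_left scaleR_add_right
          add_divide_distrib flip: sum.distrib)
    have "(\<Sum>x\<in>A. e x *\<^sub>R x) - (\<Sum>x\<in>B. e x *\<^sub>R x) = (1/r) *\<^sub>R (p - q)"
      by (simp add: comb cA cB wAB algebra_simps)
    then have "dist (\<Sum>x\<in>A. e x *\<^sub>R x) (\<Sum>x\<in>B. e x *\<^sub>R x) = dist p q / r"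
      using r by (simp add: dist_norm)
    then show ?thesis
      using hull[of A] hull[of B] cA cB wA wB unfolding r_def by blast
  qed
  define N where "N = {x \<in> A \<union> B. w x < 0}"
  have "finite N" using fin by (simp add: N_def)
  \<comment> \<open>Without a negative entry, \<open>w\<close> would be nonnegative and nonzero, so
    \<open>s > 0\<close>. The step \<open>t = 1\<close> would then produce a pair strictly closer
    than \<open>p\<close> and \<open>q\<close>, which are distinct because the hulls are
    disjoint.\<close>
  have "N \<noteq> {}"
  proof
    assume "N = {}"
    then have w0: "w x \<ge> 0" if "x \<in> A \<union> B" for x
      using that by (auto simp: N_def not_less[symmetric])
    obtain v where v: "v \<in> A \<union> B" "u v \<noteq> 0" using u(2) by blast
    then have "w v \<noteq> 0" using \<open>\<sigma> \<noteq> 0\<close> by (auto simp: w_def)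
    then have "s \<noteq> 0"
      using v wA wB w0 sum_nonneg_eq_0_iff[of A w] sum_nonneg_eq_0_iff[of B w] fin by auto
    then have "s > 0" using s0 by simp
    obtain p' q' where "p' \<in> convex hull A" "q' \<in> convex hull B"
        "dist p' q' = dist p q / (1 + 1 * s)"
      using move[of 1 "{}"] c0 w0 by auto
    moreover have "dist p q / (1 + 1 * s) < dist p q"
      using \<open>s > 0\<close> \<open>p \<noteq> q\<close> by (simp add: divide_less_eq)
    ultimately show False
      using setdist_le_dist[of p' "convex hull A" q' "convex hull B"] pq by simp
  qed
  define t where "t = Min ((\<lambda>x. c x / - w x) ` N)"
  have "t \<in> (\<lambda>x. c x / - w x) ` N"
    unfolding t_def using \<open>finite N\<close> \<open>N \<noteq> {}\<close> by (intro Min_in) auto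
  then obtain z where z: "z \<in> N" "t = c z / - w z" by blast
  have "t \<ge> 0" using z c0[of z] by (auto simp: N_def divide_nonneg_neg)
  have "0 \<le> c x + t * w x" if x: "x \<in> A \<union> B" for x
  proof (cases "x \<in> N")
    case True
    then have "t \<le> c x / - w x" "w x < 0"
      using \<open>finite N\<close> by (auto simp: t_def N_def)
    then show ?thesis
      by (simp add: le_minus_iff pos_le_divide_eq field_simps)
  next
    case False
    then have "w x \<ge> 0" using x by (auto simp: N_def)
    then show ?thesis using c0[OF x] \<open>t \<ge> 0\<close> by simp
  qed
  moreover have "c z + t * w z = 0" using z by (simp add: N_def)
  ultimately obtain p' q' where p': "p' \<in> convex hull (A - {z})"
      and q': "q' \<in> convex hull (B - {z})" and d: "dist p' q' = dist p q / (1 + t * s)"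
    using move[of t "{z}"] \<open>t \<ge> 0\<close> by auto
  \<comment> \<open>The dropped vertex was not the only one of its part: each remaining hull still
    contains one of the moved points.\<close>
  have ne': "A - {z} \<noteq> {}" "B - {z} \<noteq> {}"
    using p' q' by (metis convex_hull_empty empty_iff)+
  have le: "dist p' q' \<le> dist p q"
    unfolding d using \<open>t \<ge> 0\<close> s0 divide_left_mono[of 1 "1 + t * s" "dist p q"]
    by (simp add: add_pos_nonneg)
  have "setdist (convex hull (A - {z})) (convex hull (B - {z})) \<le> dist p' q'"
    using p' q' by (rule setdist_le_dist)
  moreover have "setdist (convex hull A) (convex hull B)
      \<le> setdist (convex hull (A - {z})) (convex hull (B - {z}))"
  proof -
    have "setdist (convex hull A) (convex hull B) \<le> setdist (convex hull (A - {z})) (convex hull B)"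
      using ne' by (intro setdist_subset_left hull_mono) (simp_all only: convex_hull_eq_empty, auto)
    also have "\<dots> \<le> setdist (convex hull (A - {z})) (convex hull (B - {z}))"
      using ne' by (intro setdist_subset_right hull_mono) (simp_all only: convex_hull_eq_empty, auto)
    finally show ?thesis .
  qed
  ultimately have "setdist (convex hull (A - {z})) (convex hull (B - {z})) =
      setdist (convex hull A) (convex hull B)"
    using le pq by simp
  moreover have "card (A - {z}) + card (B - {z}) < card A + card B"
    using z(1) card_Diff1_less[OF fin(1), of z] card_Diff1_less[OF fin(2), of z]
      card_Diff1_le[of A z] card_Diff1_le[of B z] by (auto simp: N_def)
  ultimately show thesis
    using ne' by (intro that[of "A - {z}" "B - {z}"]) auto
qed

text \<open>Vertices are removed one at a time, and \<open>card A + card B\<close> decreases.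
  Disjointness of the hulls passes to subsets, so the removal can be repeated for as long as a
  dependence remains.\<close>

lemma setdist_convex_hulls_affine_independent:
  fixes A B :: "'a::euclidean_space set"
  assumes "finite A" "finite B" "A \<noteq> {}" "B \<noteq> {}" "convex hull A \<inter> convex hull B = {}"
  shows "\<exists>A' B'. A' \<subseteq> A \<and> B' \<subseteq> B \<and> A' \<noteq> {} \<and> B' \<noteq> {} \<and> \<not> affine_dependent (A' \<union> B') \<and>
    setdist (convex hull A') (convex hull B') = setdist (convex hull A) (convex hull B)"
  using assms
proof (induction "card A + card B" arbitrary: A B rule: less_induct)
  case less
  show ?case
  proof (cases "affine_dependent (A \<union> B)")
    case True
    from setdist_convex_hulls_remove_vertex[OF less.prems True] obtain A' B' where
      *: "A' \<subseteq> A" "B' \<subseteq> B" "A' \<noteq> {}" "B' \<noteq> {}" "card A' + card B' < card A + card B"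
      "setdist (convex hull A') (convex hull B') = setdist (convex hull A) (convex hull B)"
      by metis
    have "convex hull A' \<inter> convex hull B' = {}"
      using less.prems(5) hull_mono[OF *(1), of convex] hull_mono[OF *(2), of convex] by blast
    moreover have "finite A'" "finite B'"
      using finite_subset[OF *(1)] finite_subset[OF *(2)] less.prems by blast+
    ultimately obtain A'' B'' where "A'' \<subseteq> A'" "B'' \<subseteq> B'" "A'' \<noteq> {}" "B'' \<noteq> {}"
        "\<not> affine_dependent (A'' \<union> B'')"
        "setdist (convex hull A'') (convex hull B'') = setdist (convex hull A') (convex hull B')"
      using less.hyps[of A' B'] * by blast
    then show ?thesis
      using * by (intro exI[of _ A''] exI[of _ B'']) auto
  next
    case False
    then show ?thesis using less.prems by blast
  qed
qed

section \<open>Lattice polytopes in the cube and the attained minimum\<close>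

definition cube_points :: "nat \<Rightarrow> (real ^ 'n) set" where
  "cube_points k = integer_points \<inter> {x. \<forall>i. 0 \<le> x $ i \<and> x $ i \<le> real k}"

lemma finite_cube_points: "finite (cube_points k :: (real ^ 'n) set)"
proof -
  have "vec_nth ` (cube_points k :: (real ^ 'n) set) \<subseteq> (\<Pi>\<^sub>E i\<in>UNIV. {x \<in> \<int>. \<bar>x\<bar> \<le> real k})"
    by (auto simp: cube_points_def integer_points_def)
  then have "finite (vec_nth ` (cube_points k :: (real ^ 'n) set))"
    by (rule finite_subset) (intro finite_PiE finite_abs_int_segment finite)
  then show ?thesis
    by (rule finite_imageD) (simp add: inj_on_def vec_nth_inject)
qed

text \<open>The origin lies in the set, so its affine hull is its linear span; the unit vectors lie
  in it because \<open>k\<close> is at least 1.\<close>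

lemma affine_hull_cube_points:
  assumes "k > 0"
  shows "affine hull (cube_points k) = (UNIV :: (real ^ 'n) set)"
proof -
  have "(0 :: real ^ 'n) \<in> cube_points k"
    by (simp add: cube_points_def integer_points_def)
  then have "affine hull (cube_points k) = span (cube_points k :: (real ^ 'n) set)"
    by (intro affine_hull_span_0 hull_inc)
  moreover have "Basis \<subseteq> (cube_points k :: (real ^ 'n) set)"
    using assms by (auto simp: Basis_vec_def cube_points_def integer_points_def axis_def)
  ultimately show ?thesis
    by (metis span_Basis span_mono top.extremum_uniqueI)
qed

text \<open>This trades polytopes for finite vertex sets. One direction is the
  Krein-Milman-Minkowski theorem; the other holds since extreme points of a hull are among its
  generators and the cube is convex.\<close>

lemma lattice_dk_polytope_iff_cube_points:
  "lattice_dk_polytope k P \<longleftrightarrow> (\<exists>A \<subseteq> cube_points k. A \<noteq> {} \<and> P = convex hull A)"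
proof
  assume P: "lattice_dk_polytope k P"
  then have "polytope P" "P \<noteq> {}"
    by (auto simp: lattice_dk_polytope_def lattice_polytope_def)
  then have "P = convex hull {v. v extreme_point_of P}"
    by (intro Krein_Milman_Minkowski polytope_imp_compact polytope_imp_convex)
  moreover have "{v. v extreme_point_of P} \<subseteq> cube_points k"
    using P by (auto simp: lattice_dk_polytope_def lattice_polytope_def cube_points_def
        extreme_point_of_def)
  ultimately show "\<exists>A \<subseteq> cube_points k. A \<noteq> {} \<and> P = convex hull A"
    using \<open>P \<noteq> {}\<close> by (metis convex_hull_eq_empty)
next
  assume "\<exists>A \<subseteq> cube_points k. A \<noteq> {} \<and> P = convex hull A"
  then obtain A where A: "A \<subseteq> cube_points k" "A \<noteq> {}" "P = convex hull A" by blast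
  have "finite A" using A(1) finite_cube_points finite_subset by blast
  have "{v. v extreme_point_of P} \<subseteq> A"
    using A(3) extreme_point_of_convex_hull by blast
  moreover have "convex {x :: real ^ 'a. \<forall>i. 0 \<le> x $ i \<and> x $ i \<le> real k}"
    by (auto simp: convex_def intro!: convex_bound_le)
  then have "P \<subseteq> {x. \<forall>i. 0 \<le> x $ i \<and> x $ i \<le> real k}"
    unfolding A(3) using A(1) by (intro hull_minimal) (auto simp: cube_points_def)
  ultimately show "lattice_dk_polytope k P"
    using A \<open>finite A\<close> unfolding lattice_dk_polytope_def lattice_polytope_def polytope_def
    by (auto simp: cube_points_def)
qed

lemma finite_lattice_distances:
  "finite {setdist P Q | P Q :: (real ^ 'n) set.
     lattice_dk_polytope k P \<and> lattice_dk_polytope k Q \<and> P \<inter> Q = {}}"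
    (is "finite ?D")
proof -
  let ?V = "cube_points k :: (real ^ 'n) set"
  have "?D \<subseteq> (\<lambda>(A, B). setdist (convex hull A) (convex hull B)) ` (Pow ?V \<times> Pow ?V)"
    by (fastforce simp: lattice_dk_polytope_iff_cube_points)
  then show ?thesis
    by (rule finite_subset) (simp add: finite_cube_points)
qed

lemma lattice_eps_le:
  fixes P Q :: "(real ^ 'n) set"
  assumes "lattice_dk_polytope k P" "lattice_dk_polytope k Q" "P \<inter> Q = {}"
  shows "lattice_eps TYPE('n) k \<le> setdist P Q"
  unfolding lattice_eps_def using assms
  by (intro cInf_lower bdd_below_finite finite_lattice_distances) blast

lemma lattice_eps_attained:
  assumes "k > 0"
  obtains P Q :: "(real ^ 'n) set" where "lattice_dk_polytope k P" "lattice_dk_polytope k Q"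
    "P \<inter> Q = {}" "setdist P Q = lattice_eps TYPE('n) k"
proof -
  let ?D = "{setdist P Q | P Q :: (real ^ 'n) set.
     lattice_dk_polytope k P \<and> lattice_dk_polytope k Q \<and> P \<inter> Q = {}}"
  \<comment> \<open>Two opposite cube vertices, the origin and the all-ones vector, show that
    disjoint pairs exist, so that the infimum is over a nonempty finite set.\<close>
  have "(0 :: real ^ 'n) \<in> cube_points k" "(1 :: real ^ 'n) \<in> cube_points k"
    using assms by (auto simp: cube_points_def integer_points_def)
  then have "lattice_dk_polytope k {0 :: real ^ 'n}" "lattice_dk_polytope k {1 :: real ^ 'n}"
    unfolding lattice_dk_polytope_iff_cube_points
    by (metis convex_hull_singleton empty_subsetI insert_subset insert_not_empty)+
  moreover have "{0 :: real ^ 'n} \<inter> {1} = {}" by simp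
  ultimately have "?D \<noteq> {}" by blast
  moreover have "Inf D \<in> D" if "finite D" "D \<noteq> {}" for D :: "real set"
    using that by (simp add: cInf_eq_Min)
  ultimately have "Inf ?D \<in> ?D"
    using finite_lattice_distances by blast
  then show thesis
    using that unfolding lattice_eps_def by auto
qed

text \<open>The bound \<open>m \<ge> 0\<close> rules out the empty simplex of dimension -1, hence
  \<open>C \<noteq> {}\<close>.\<close>

lemma affine_independent_imp_simplex:
  assumes "\<not> affine_dependent C" "C \<noteq> {}"
  shows "\<exists>m\<ge>0. m simplex (convex hull C)"
proof -
  have "card C > 0" using assms by (simp add: aff_independent_finite card_gt_0_iff)
  then have "0 \<le> int (card C) - 1" "(int (card C) - 1) simplex (convex hull C)"
    using assms(1) by (auto simp: simplex_def)
  then show ?thesis by blast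
qed

section \<open>Completion to an affine basis\<close>

theorem theorem5p2:
  fixes k :: nat
  assumes "k > 0"
  shows "\<exists>P Q :: (real ^ 'n) set.
           lattice_dk_polytope k P \<and> lattice_dk_polytope k Q \<and>
           setdist P Q = lattice_eps TYPE('n) k \<and>
           (\<exists>m\<ge>0. m simplex P) \<and> (\<exists>m\<ge>0. m simplex Q) \<and>
           aff_dim P + aff_dim Q = int CARD('n) - 1 \<and>
           affine hull P \<inter> affine hull Q = {}"
proof -
  let ?V = "cube_points k :: (real ^ 'n) set"
  obtain A0 B0 :: "(real ^ 'n) set" where 0: "A0 \<subseteq> ?V" "B0 \<subseteq> ?V" "A0 \<noteq> {}" "B0 \<noteq> {}"
      "convex hull A0 \<inter> convex hull B0 = {}"
      "setdist (convex hull A0) (convex hull B0) = lattice_eps TYPE('n) k"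
    using lattice_eps_attained[OF assms] unfolding lattice_dk_polytope_iff_cube_points by metis
  have "finite A0" "finite B0"
    using 0 finite_cube_points finite_subset by blast+
  then obtain A1 B where 1: "A1 \<subseteq> A0" "B \<subseteq> B0" "A1 \<noteq> {}" "B \<noteq> {}"
      "\<not> affine_dependent (A1 \<union> B)"
      "setdist (convex hull A1) (convex hull B) = lattice_eps TYPE('n) k"
    using setdist_convex_hulls_affine_independent[of A0 B0] 0 by metis
  have A1B: "A1 \<inter> B = {}"
    using 0(5) 1(1,2) hull_subset[of A0 convex] hull_subset[of B0 convex] by blast
  have "A1 \<union> B \<subseteq> ?V" using 0 1 by blast
  \<comment> \<open>The added points are taken from \<open>?V\<close>, so the enlarged hulls remain
    lattice polytopes in the cube.\<close>
  then obtain T where T: "\<not> affine_dependent T" "A1 \<union> B \<subseteq> T" "T \<subseteq> ?V"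
      "affine hull T = affine hull ?V"
    using extend_to_affine_basis[OF 1(5)] by metis
  \<comment> \<open>All new points go to the first part, while \<open>B\<close> stays fixed.\<close>
  define A where "A = T - B"
  have A: "A \<union> B = T" "A \<inter> B = {}" "A1 \<subseteq> A"
    using T(2) A1B by (auto simp: A_def)
  have indep: "\<not> affine_dependent A" "\<not> affine_dependent B"
    using T(1) A(1) affine_independent_subset by blast+
  have ne: "A \<noteq> {}" using A 1 by blast
  have dk: "lattice_dk_polytope k (convex hull A)" "lattice_dk_polytope k (convex hull B)"
    unfolding lattice_dk_polytope_iff_cube_points using T(3) A(1) ne 1(4) by blast+
  \<comment> \<open>Disjoint parts of an affinely independent set have disjoint affine hulls. This
    also makes the enlarged pair admissible for the minimum, so its distance cannot fall below
    \<open>lattice_eps\<close>.\<close>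
  have disj: "affine hull A \<inter> affine hull B = {}"
    using disjoint_affine_hull[OF T(1)] A by blast
  then have "convex hull A \<inter> convex hull B = {}"
    using convex_hull_subset_affine_hull by blast
  then have "lattice_eps TYPE('n) k \<le> setdist (convex hull A) (convex hull B)"
    by (rule lattice_eps_le[OF dk])
  moreover have "setdist (convex hull A) (convex hull B) \<le> setdist (convex hull A1) (convex hull B)"
    using 1(3) A(3) by (intro setdist_subset_left hull_mono) auto
  ultimately have eq: "setdist (convex hull A) (convex hull B) = lattice_eps TYPE('n) k"
    using 1(6) by simp
  have "aff_dim T = int CARD('n)"
    using T(4) affine_hull_cube_points[OF assms]
    by (metis aff_dim_affine_hull aff_dim_UNIV DIM_cart DIM_real mult.right_neutral)
  then have "int (card T) = int CARD('n) + 1"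
    using aff_dim_affine_independent[OF T(1)] by simp
  moreover have "card T = card A + card B"
    using A aff_independent_finite indep card_Un_disjoint by metis
  \<comment> \<open>Each part has dimension one less than its number of points, and the
    \<open>CARD('n) + 1\<close> points of \<open>T\<close> are split in two; hence the total
    \<open>CARD('n) - 1\<close>.\<close>
  ultimately have "aff_dim (convex hull A) + aff_dim (convex hull B) = int CARD('n) - 1"
    using indep by (simp add: aff_dim_convex_hull aff_dim_affine_independent)
  then show ?thesis
    using dk eq disj affine_independent_imp_simplex[OF indep(1) ne]
      affine_independent_imp_simplex[OF indep(2) 1(4)]
    by (intro exI[of _ "convex hull A"] exI[of _ "convex hull B"]) simp
qed

end
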